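(* Let $c>0$, $c_1>0$, $\alpha>0$. Suppose $f:[0,1]^2\to\mathbb{R}$ is a $(c,\alpha)$-mixed Hölder function that is sampled at $l$ points $X_1,\dots,X_l$ chosen (independently and) uniformly at random from the unit square $[0,1]^2$, and let the locations $X_1,\dots,X_l$ and the function values $f(X_1),\dots,f(X_l)$ be given. Let $n$ be a positive integer. If $l\ge c_1 n\log^2 n$, then one can compute from this data an approximation $I\in\mathbb{R}$ of the integral of $f$ on $[0,1]^2$ such that $$\int_{[0,1]^2}f(x)\,dx=I+\mathcal{O}\big(n^{-\alpha}\log^{3/2}n\big)$$ with probability at least $1-n^{2-c_1}$, where the implicit constant depends only on $c$ and $c_1$.
   Context: A function $f:[0,1]^2\to\mathbb{R}$ is $(c,\alpha)$-mixed Hölder if for all $x,x',y,y'\in[0,1]$: $|f(x',y)-f(x,y)|\le c|x'-x|^\alpha$, $|f(x,y')-f(x,y)|\le c|y'-y|^\alpha$, and $|f(x',y')-f(x,y')-f(x',y)+f(x,y)|\le c(|x'-x||y'-y|)^\alpha$. "One can compute from this data" means: $I$ is the output of a map whose only information about the particular function $f$ is the data $X_1,\dots,X_l$, $f(X_1),\dots,f(X_l)$ (the map may depend on the parameters $n,l,c,\alpha,c_1$ but not on $f$). The function $f$ is fixed and the probability is over the random choice of $X_1,\dots,X_l$. $\log$ is the natural logarithm, and $\log^p n=(\log n)^p$. *)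

theory Defs
  imports "HOL-Probability.Probability"
begin

definition unit_square :: "(real \<times> real) set" where
  "unit_square = {0..1} \<times> {0..1}"

text \<open>Only the values of \<open>f\<close> on the unit square are constrained.\<close>

definition mixed_holder :: "real \<Rightarrow> real \<Rightarrow> (real \<times> real \<Rightarrow> real) \<Rightarrow> bool" where
  "mixed_holder c \<alpha> f \<longleftrightarrow>
     (\<forall>x\<in>{0..1}. \<forall>x'\<in>{0..1}. \<forall>y\<in>{0..1}. \<forall>y'\<in>{0..1}.
        \<bar>f (x', y) - f (x, y)\<bar> \<le> c * \<bar>x' - x\<bar> powr \<alpha> \<and>
        \<bar>f (x, y') - f (x, y)\<bar> \<le> c * \<bar>y' - y\<bar> powr \<alpha> \<and>
        \<bar>f (x', y') - f (x, y') - f (x', y) + f (x, y)\<bar>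
          \<le> c * (\<bar>x' - x\<bar> * \<bar>y' - y\<bar>) powr \<alpha>)"

text \<open>
  The joint law of \<open>l\<close> independent uniform points of the unit square. Since the square has
  area 1, Lebesgue measure restricted to it is the uniform distribution. Its underlying space
  is the square itself, so the values of \<open>f\<close> elsewhere play no role.
\<close>

definition uniform_points :: "nat \<Rightarrow> (nat \<Rightarrow> real \<times> real) measure" where
  "uniform_points l = (\<Pi>\<^sub>M i\<in>{..<l}. restrict_space lborel unit_square)"

lemma prob_space_uniform_points: "prob_space (uniform_points l)"
proof -
  have sq: "unit_square = cbox (0, 0) (1, 1)"
    by (simp add: unit_square_def cbox_Pair_eq)
  have "emeasure lborel unit_square = 1"
    by (simp add: sq emeasure_lborel_cbox_eq Basis_prod_def)
  then have "prob_space (restrict_space lborel unit_square)"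
    by (intro prob_spaceI) (simp add: space_restrict_space emeasure_restrict_space sq)
  then interpret product_prob_space "\<lambda>_::nat. restrict_space lborel unit_square" "{..<l}"
    by (intro product_prob_spaceI)
  show ?thesis
    unfolding uniform_points_def by (rule prob_space_axioms)
qed

text \<open>
  A list of exactly \<open>l\<close> entries, so that a map applied to it sees nothing else of \<open>f\<close>;
  the function \<open>f \<circ> X\<close> would also reveal a value of \<open>f\<close> at \<open>X i\<close> for \<open>i \<ge> l\<close>.
\<close>

definition sample_data ::
    "(real \<times> real \<Rightarrow> real) \<Rightarrow> nat \<Rightarrow> (nat \<Rightarrow> real \<times> real) \<Rightarrow> ((real \<times> real) \<times> real) list" where
  "sample_data f l X = map (\<lambda>i. (X i, f (X i))) [0..<l]"

end

theory Submission
  imports Defs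
begin

text \<open>
  For \<open>\<alpha> > 1\<close> the function is constant on the square, so one sample suffices. For \<open>\<alpha> \<le> 1\<close> the
  plain Hoelder bounds are enough: cut the square into \<open>N\<^sup>2\<close> equal cells with \<open>N = \<lfloor>sqrt n\<rfloor>\<close>
  and average the values of \<open>f\<close> at the first sample falling into each cell. Conditionally on the
  cells visited by the samples, these points are independent and uniform in their cells, and \<open>f\<close>
  oscillates by at most \<open>2 c N powr (-\<alpha>)\<close> on a cell. Hoeffding's inequality over \<open>N\<^sup>2\<close> terms
  gives an error of order \<open>N powr (-\<alpha>) / N * sqrt (ln n)\<close>, which is at most of order
  \<open>n powr (-\<alpha>) * sqrt (ln n)\<close> because \<open>\<alpha> \<le> 1\<close>. A cell is missed by all \<open>l\<close> samples with
  probability at most \<open>exp (-l / n)\<close>, which \<open>l \<ge> c1 n (ln n)\<^sup>2\<close> makes negligible.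
\<close>

subsection \<open>Stratified sampling with one point per stratum\<close>

text \<open>The cell map is a parameter so that the notion also applies to a bare pattern of cells,
  with the identity as cell map.\<close>

definition first_hit :: "('a \<Rightarrow> 'k) \<Rightarrow> (nat \<Rightarrow> 'a) \<Rightarrow> nat \<Rightarrow> bool" where
  "first_hit cell X i \<longleftrightarrow> (\<forall>j<i. cell (X j) \<noteq> cell (X i))"

text \<open>The estimator before normalisation, defined on lists of location-value pairs so that it
  is a function of the data alone.\<close>

definition first_hit_sum :: "('a \<Rightarrow> 'k) \<Rightarrow> ('a \<times> real) list \<Rightarrow> real" where
  "first_hit_sum cell xs =
     (\<Sum>i<length xs. if first_hit cell (\<lambda>j. fst (xs ! j)) i then snd (xs ! i) else 0)"

lemma first_hit_cong:
  assumes "\<And>j. j \<le> i \<Longrightarrow> cell (X j) = cell' (Y j)"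
  shows "first_hit cell X i \<longleftrightarrow> first_hit cell' Y i"
  using assms by (auto simp: first_hit_def)

lemma first_hit_sum_sample_data:
  "first_hit_sum cell (sample_data f l X) = (\<Sum>i<l. if first_hit cell X i then f (X i) else 0)"
proof -
  have "first_hit cell (\<lambda>j. fst (sample_data f l X ! j)) i \<longleftrightarrow> first_hit cell X i" if "i < l" for i
    using that by (intro first_hit_cong) (simp add: sample_data_def)
  then show ?thesis
    unfolding first_hit_sum_def by (intro sum.cong) (auto simp: sample_data_def)
qed

text \<open>Of two distinct indices with the same cell, the larger one is not a first hit.\<close>

lemma inj_on_first_hits: "inj_on (\<lambda>i. cell (X i)) {i. first_hit cell X i}"
proof (rule inj_onI)
  fix i j assume *: "i \<in> {i. first_hit cell X i}" "j \<in> {i. first_hit cell X i}" "cell (X i) = cell (X j)"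
  show "i = j"
    using * by (cases i j rule: linorder_cases) (auto simp: first_hit_def)
qed

text \<open>The least index that visits a given cell is a first hit. Together with injectivity, the
  first hits below \<open>l\<close> correspond one to one to the visited cells.\<close>

lemma image_first_hits: "(\<lambda>i. cell (X i)) ` {i. i < l \<and> first_hit cell X i} = (\<lambda>i. cell (X i)) ` {..<l}"
proof safe
  fix i assume "i < l"
  define j where "j = (LEAST j. cell (X j) = cell (X i))"
  have eq: "cell (X j) = cell (X i)"
    unfolding j_def by (rule LeastI[where k = i]) (rule refl)
  have le: "j \<le> i"
    unfolding j_def by (rule Least_le) (rule refl)
  have "cell (X k) \<noteq> cell (X i)" if "k < j" for k
    using that unfolding j_def by (rule not_less_Least)
  then have "first_hit cell X j"
    by (simp add: first_hit_def eq)
  then have "j \<in> {i. i < l \<and> first_hit cell X i}"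
    using le \<open>i < l\<close> by simp
  with eq show "cell (X i) \<in> (\<lambda>i. cell (X i)) ` {i. i < l \<and> first_hit cell X i}"
    by (metis (mono_tags, lifting) imageI)
qed auto

section \<open>Partitions of a probability space into strata of equal probability\<close>

text \<open>Isolates what the probabilistic argument uses of the grid on the square: finitely many
  cells, all equally likely. Measurability into \<open>count_space K\<close> also forces every point
  of the space to have its cell in \<open>K\<close>.\<close>

locale equal_stratification = prob_space M
  for M :: "'a measure" +
  fixes cell :: "'a \<Rightarrow> 'k" and K :: "'k set"
  assumes finite_K: "finite K" and K_nonempty: "K \<noteq> {}"
    and measurable_cell [measurable]: "cell \<in> measurable M (count_space K)"
    and prob_cell: "k \<in> K \<Longrightarrow> prob {x \<in> space M. cell x = k} = 1 / card K"
begin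

abbreviation samples :: "nat \<Rightarrow> (nat \<Rightarrow> 'a) measure" where
  "samples l \<equiv> \<Pi>\<^sub>M i\<in>{..<l}. M"

definition stratum :: "'k \<Rightarrow> 'a set" where
  "stratum k = {x \<in> space M. cell x = k}"

definition stratum_mean :: "('a \<Rightarrow> real) \<Rightarrow> 'k \<Rightarrow> real" where
  "stratum_mean f k = integral\<^sup>L (uniform_measure M (stratum k)) f"

lemma card_K_pos: "0 < card K"
  using finite_K K_nonempty by (simp add: card_gt_0_iff)

lemma cell_in_K: "x \<in> space M \<Longrightarrow> cell x \<in> K"
  using measurable_space[OF measurable_cell] by simp

lemma space_samples: "X \<in> space (samples l) \<Longrightarrow> i < l \<Longrightarrow> X i \<in> space M"
  by (auto simp: space_PiM)

lemma measurable_sample: "h \<in> measurable M N \<Longrightarrow> i < l \<Longrightarrow> (\<lambda>X. h (X i)) \<in> measurable (samples l) N"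
  by (rule measurable_compose[of "\<lambda>X. X i" _ M]) (simp_all add: measurable_component_singleton)

lemma sets_stratum [measurable]: "stratum k \<in> sets M"
proof (cases "k \<in> K")
  case True
  have "stratum k = cell -` {k} \<inter> space M"
    by (auto simp: stratum_def)
  then show ?thesis
    using True measurable_sets[OF measurable_cell, of "{k}"] by simp
next
  case False
  then have "stratum k = {}"
    using cell_in_K by (auto simp: stratum_def)
  then show ?thesis by simp
qed

lemma emeasure_stratum: "k \<in> K \<Longrightarrow> emeasure M (stratum k) = ennreal (1 / card K)"
  using prob_cell[of k] by (simp add: emeasure_eq_measure stratum_def)

lemma sum_indicator_strata: "x \<in> space M \<Longrightarrow> (\<Sum>k\<in>K. indicator (stratum k) x *\<^sub>R f x) = (f x :: real)"
proof -
  assume x: "x \<in> space M"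
  have "(\<Sum>k\<in>K. indicator (stratum k) x *\<^sub>R f x) = (\<Sum>k\<in>K. if k = cell x then f x else 0)"
    using x by (intro sum.cong) (auto simp: stratum_def indicator_def)
  then show ?thesis
    using cell_in_K[OF x] finite_K by simp
qed

text \<open>The law of total expectation. All strata have weight \<open>1 / card K\<close>, so an
  unweighted average with one value per stratum is centred at \<open>expectation f\<close>.\<close>

lemma sum_stratum_mean:
  assumes "integrable M f"
  shows "(\<Sum>k\<in>K. stratum_mean f k) = card K * expectation f"
proof -
  have [measurable]: "f \<in> borel_measurable M"
    using assms by simp
  have "stratum_mean f k = card K * (\<integral>x. indicator (stratum k) x *\<^sub>R f x \<partial>M)" if "k \<in> K" for k
  proof -
    \<comment> \<open>The density of the conditional law is rewritten as a real function, the form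
      that \<open>integral_density\<close> expects.\<close>
    have "indicator (stratum k) x / emeasure M (stratum k) = ennreal (card K * indicat_real (stratum k) x)" for x
      using card_K_pos
      by (auto simp: emeasure_stratum[OF that] indicator_def inverse_ennreal divide_ennreal_def)
    then have "uniform_measure M (stratum k) = density M (\<lambda>x. ennreal (card K * indicat_real (stratum k) x))"
      unfolding uniform_measure_def by simp
    then show ?thesis
      unfolding stratum_mean_def by (simp add: integral_density mult.assoc)
  qed
  then have "(\<Sum>k\<in>K. stratum_mean f k) = card K * (\<Sum>k\<in>K. \<integral>x. indicator (stratum k) x *\<^sub>R f x \<partial>M)"
    by (simp add: sum_distrib_left)
  also have "(\<Sum>k\<in>K. \<integral>x. indicator (stratum k) x *\<^sub>R f x \<partial>M) = (\<integral>x. (\<Sum>k\<in>K. indicator (stratum k) x *\<^sub>R f x) \<partial>M)"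
    by (rule Bochner_Integration.integral_sum[symmetric]) (intro integrable_mult_indicator assms sets_stratum)
  also have "\<dots> = expectation f"
    by (intro Bochner_Integration.integral_cong refl) (rule sum_indicator_strata)
  finally show ?thesis .
qed

section \<open>Exponential moments given the pattern of visited cells\<close>

text \<open>Hoeffding's lemma for the conditional law: on the stratum \<open>f\<close> stays in an
  interval of length \<open>2 * w\<close>, and \<open>(2 * w)\<^sup>2 / 8 = w\<^sup>2 / 2\<close>.
  The bound is multiplied by the measure of the stratum to fit the integrals over a fixed cell
  pattern.\<close>

lemma nn_integral_stratum_exp_le:
  assumes [measurable]: "f \<in> borel_measurable M" and "s > 0" and k: "k \<in> K"
    and osc: "\<And>x y. x \<in> space M \<Longrightarrow> y \<in> space M \<Longrightarrow> cell x = cell y \<Longrightarrow> \<bar>f x - f y\<bar> \<le> w"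
  shows "(\<integral>\<^sup>+x. ennreal (exp (s * (f x - stratum_mean f k))) * indicator (stratum k) x \<partial>M)
           \<le> ennreal (exp (s\<^sup>2 * w\<^sup>2 / 2)) * emeasure M (stratum k)" (is "?L \<le> _")
proof -
  have em: "emeasure M (stratum k) \<noteq> 0" "emeasure M (stratum k) \<noteq> \<infinity>"
    using card_K_pos by (simp_all add: emeasure_stratum[OF k])
  then have self: "emeasure M (stratum k) / emeasure M (stratum k) = 1"
    by (intro ennreal_divide_self) (auto simp: emeasure_eq_measure)
  \<comment> \<open>A stratum of positive measure is nonempty; any of its points can be the centre
    of the range of \<open>f\<close>.\<close>
  obtain y where y: "y \<in> stratum k"
    using em(1)
    by fastforce
  interpret U: prob_space "uniform_measure M (stratum k)"
    using em by (rule prob_space_uniform_measure)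
  interpret U: interval_bounded_random_variable "uniform_measure M (stratum k)" f "f y - w" "f y + w"
  proof
    have "f x \<in> {f y - w..f y + w}" if "x \<in> stratum k" for x
      using osc[of x y] y that by (auto simp: stratum_def abs_le_iff)
    then show "AE x in uniform_measure M (stratum k). f x \<in> {f y - w..f y + w}"
      by (intro AE_uniform_measureI sets_stratum AE_I2) auto
  qed simp
  have "(\<integral>\<^sup>+x. ennreal (exp (s * (f x - stratum_mean f k))) * indicator (stratum k) x \<partial>M) / emeasure M (stratum k)
          = (\<integral>\<^sup>+x. ennreal (exp (s * (f x - stratum_mean f k))) \<partial>uniform_measure M (stratum k))"
    by (rule nn_integral_uniform_measure[symmetric]) measurable
  also have "\<dots> \<le> ennreal (exp (s\<^sup>2 * (f y + w - (f y - w))\<^sup>2 / 8))"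
    unfolding stratum_mean_def by (rule U.Hoeffdings_lemma_nn_integral[OF \<open>s > 0\<close>])
  also have "s\<^sup>2 * (f y + w - (f y - w))\<^sup>2 / 8 = s\<^sup>2 * w\<^sup>2 / 2"
    by (simp add: power2_eq_square)
  finally have "?L / emeasure M (stratum k) \<le> ennreal (exp (s\<^sup>2 * w\<^sup>2 / 2))" .
  then have "?L / emeasure M (stratum k) * emeasure M (stratum k) \<le> ennreal (exp (s\<^sup>2 * w\<^sup>2 / 2)) * emeasure M (stratum k)"
    by (rule mult_right_mono) simp
  then show ?thesis
    using self by (simp add: ennreal_divide_times)
qed

text \<open>
  The factor \<open>h \<sigma> i\<close> may depend on the cells \<open>\<sigma>\<close> of all samples; on the event that the samples
  follow a fixed pattern \<open>\<sigma>\<close> the integral factorizes, which replaces conditioning on the cells.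
\<close>

lemma nn_integral_cell_pattern_prod_le:
  fixes h :: "(nat \<Rightarrow> 'k) \<Rightarrow> nat \<Rightarrow> 'a \<Rightarrow> ennreal"
  assumes h: "\<And>\<sigma> i. i < l \<Longrightarrow> h \<sigma> i \<in> borel_measurable M"
    and le: "\<And>\<sigma> i. \<sigma> \<in> {..<l} \<rightarrow>\<^sub>E K \<Longrightarrow> i < l \<Longrightarrow>
                 (\<integral>\<^sup>+x. h \<sigma> i x * indicator (stratum (\<sigma> i)) x \<partial>M) \<le> emeasure M (stratum (\<sigma> i))"
  shows "(\<integral>\<^sup>+X. (\<Prod>i<l. h (\<lambda>i\<in>{..<l}. cell (X i)) i (X i)) \<partial>(samples l)) \<le> 1"
proof -
  interpret P: product_prob_space "\<lambda>_::nat. M" "{..<l}"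
    by (rule product_prob_spaceI) (rule prob_space_axioms)
  let ?g = "\<lambda>\<sigma> i x. h \<sigma> i x * indicator (stratum (\<sigma> i)) x"
  have g: "?g \<sigma> i \<in> borel_measurable M" if "i < l" for \<sigma> i
    using h[OF that] by (intro borel_measurable_times_ennreal borel_measurable_indicator sets_stratum)
  \<comment> \<open>For given samples only their actual pattern contributes to the sum: any other
    pattern differs at some index, where the indicator vanishes.\<close>
  have decomp: "(\<Prod>i<l. h (\<lambda>i\<in>{..<l}. cell (X i)) i (X i)) = (\<Sum>\<sigma>\<in>{..<l} \<rightarrow>\<^sub>E K. \<Prod>i<l. ?g \<sigma> i (X i))"
    if X: "X \<in> space (samples l)" for X
  proof -
    let ?\<sigma> = "\<lambda>i\<in>{..<l}. cell (X i)"
    have sp: "X i \<in> space M" if "i < l" for i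
      using X that by (rule space_samples)
    have \<sigma>: "?\<sigma> \<in> {..<l} \<rightarrow>\<^sub>E K"
      using sp cell_in_K by auto
    have "(\<Prod>i<l. ?g \<sigma> i (X i)) = 0" if "\<sigma> \<in> ({..<l} \<rightarrow>\<^sub>E K) - {?\<sigma>}" for \<sigma>
    proof -
      have "\<exists>i<l. \<sigma> i \<noteq> cell (X i)"
      proof (rule ccontr)
        assume "\<not> ?thesis"
        then have "\<sigma> = ?\<sigma>"
          using that by (auto simp: fun_eq_iff PiE_def extensional_def)
        then show False using that by blast
      qed
      then obtain i where "i < l" "\<sigma> i \<noteq> cell (X i)" by blast
      then have "?g \<sigma> i (X i) = 0"
        by (auto simp: stratum_def indicator_def)
      with \<open>i < l\<close> show ?thesis by (intro prod_zero) auto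
    qed
    then have "(\<Sum>\<sigma>\<in>{..<l} \<rightarrow>\<^sub>E K. \<Prod>i<l. ?g \<sigma> i (X i)) = (\<Prod>i<l. ?g ?\<sigma> i (X i))"
      using \<sigma> by (subst sum.remove[OF _ \<sigma>]) (auto simp: finite_PiE finite_K)
    also have "\<dots> = (\<Prod>i<l. h ?\<sigma> i (X i))"
      using sp by (intro prod.cong) (auto simp: stratum_def)
    finally show ?thesis by simp
  qed
  have "(\<integral>\<^sup>+X. (\<Prod>i<l. h (\<lambda>i\<in>{..<l}. cell (X i)) i (X i)) \<partial>(samples l))
          = (\<integral>\<^sup>+X. (\<Sum>\<sigma>\<in>{..<l} \<rightarrow>\<^sub>E K. \<Prod>i<l. ?g \<sigma> i (X i)) \<partial>(samples l))"
    by (intro nn_integral_cong decomp)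
  also have "\<dots> = (\<Sum>\<sigma>\<in>{..<l} \<rightarrow>\<^sub>E K. \<integral>\<^sup>+X. (\<Prod>i<l. ?g \<sigma> i (X i)) \<partial>(samples l))"
  proof (rule nn_integral_sum)
    fix \<sigma>
    have "(\<lambda>X. ?g \<sigma> i (X i)) \<in> borel_measurable (samples l)" if "i \<in> {..<l}" for i
      using that by (intro measurable_sample[where h = "?g \<sigma> i"] g) auto
    then show "(\<lambda>X. \<Prod>i<l. ?g \<sigma> i (X i)) \<in> borel_measurable (samples l)"
      by (rule borel_measurable_prod_ennreal)
  qed
  \<comment> \<open>With \<open>\<sigma>\<close> fixed, the factor with index \<open>i\<close>
    depends on \<open>X i\<close> alone, so independence applies.\<close>
  also have "\<dots> = (\<Sum>\<sigma>\<in>{..<l} \<rightarrow>\<^sub>E K. \<Prod>i<l. \<integral>\<^sup>+x. ?g \<sigma> i x \<partial>M)"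
  proof (rule sum.cong[OF refl])
    fix \<sigma>
    show "(\<integral>\<^sup>+X. (\<Prod>i<l. ?g \<sigma> i (X i)) \<partial>(samples l)) = (\<Prod>i<l. \<integral>\<^sup>+x. ?g \<sigma> i x \<partial>M)"
      by (rule P.product_nn_integral_prod[OF finite_lessThan]) (rule g, simp)
  qed
  also have "\<dots> \<le> (\<Sum>\<sigma>\<in>{..<l} \<rightarrow>\<^sub>E K. \<Prod>i<l. emeasure M (stratum (\<sigma> i)))"
    by (intro sum_mono prod_mono_ennreal le) auto
  \<comment> \<open>Summing the products over all patterns gives a product of sums, each of which is
    the total mass 1.\<close>
  also have "\<dots> = (\<Prod>i<l. \<Sum>k\<in>K. emeasure M (stratum k))"
    by (rule prod_sum_PiE[symmetric]) (auto simp: finite_K)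
  also have "(\<Sum>k\<in>K. emeasure M (stratum k)) = 1"
    using card_K_pos by (simp add: emeasure_stratum ennreal_of_nat_eq_real_of_nat flip: ennreal_mult)
  finally show ?thesis by (simp only: prod.neutral_const)
qed

text \<open>As \<open>K\<close> is finite, the condition is a finite Boolean combination of events
  \<open>cell (X j) = k\<close>.\<close>

lemma measurable_first_hit [measurable]:
  assumes "i < l"
  shows "Measurable.pred (samples l) (\<lambda>X. first_hit cell X i)"
proof -
  have [measurable]: "(\<lambda>X. cell (X j)) \<in> measurable (samples l) (count_space K)" if "j < l" for j
    using that by (rule measurable_sample[OF measurable_cell])
  have eq: "first_hit cell X i \<longleftrightarrow> (\<forall>j\<in>{..<i}. \<forall>k\<in>K. \<not> (cell (X j) = k \<and> cell (X i) = k))"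
    if "X \<in> space (samples l)" for X
  proof -
    have "X i \<in> space M"
      using that assms by (rule space_samples)
    then show ?thesis
      using cell_in_K[of "X i"] unfolding first_hit_def by (metis lessThan_iff)
  qed
  have "Measurable.pred (samples l) (\<lambda>X. \<forall>j\<in>{..<i}. \<forall>k\<in>K. \<not> (cell (X j) = k \<and> cell (X i) = k))"
    using assms finite_K
    by (intro pred_intros_finite pred_intros_logic pred_count_space_const1 measurable_sample[of cell]
          measurable_compose[OF measurable_cell, of "\<lambda>k. k"]) auto
  then show ?thesis
    by (subst measurable_cong[OF eq])
qed


section \<open>Tail bound for the centred sum over first hits\<close>

text \<open>Each first hit is centred by the mean of its own stratum, so that given the cell pattern
  the summands are independent with mean zero.\<close>

definition centred_hit_sum :: "('a \<Rightarrow> real) \<Rightarrow> nat \<Rightarrow> (nat \<Rightarrow> 'a) \<Rightarrow> real" where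
  "centred_hit_sum f l X = (\<Sum>i<l. if first_hit cell X i then f (X i) - stratum_mean f (cell (X i)) else 0)"

lemma measurable_centred_hit_sum:
  assumes "f \<in> borel_measurable M"
  shows "centred_hit_sum f l \<in> borel_measurable (samples l)"
proof -
  have mean: "(\<lambda>x. stratum_mean f (cell x)) \<in> borel_measurable M"
    by (rule measurable_compose[OF measurable_cell]) simp
  have "(\<lambda>X. if first_hit cell X i then f (X i) - stratum_mean f (cell (X i)) else 0)
          \<in> borel_measurable (samples l)" if "i < l" for i
    using that assms mean measurable_first_hit[OF that, unfolded pred_def]
    by (intro measurable_If borel_measurable_diff
          measurable_sample[of f] measurable_sample[of "\<lambda>x. stratum_mean f (cell x)"] borel_measurable_const)
  then show ?thesis
    unfolding centred_hit_sum_def by (intro borel_measurable_sum) auto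
qed

text \<open>Whether an index is a first hit is decided by the cell pattern. Given the pattern, each
  first hit contributes a factor of mean at most 1 by Hoeffding's lemma, and every other index
  contributes 1. Normalising each factor separately copes with the random number of first
  hits.\<close>

lemma nn_integral_first_hits_le:
  assumes f: "f \<in> borel_measurable M" and "s > 0"
    and osc: "\<And>x y. x \<in> space M \<Longrightarrow> y \<in> space M \<Longrightarrow> cell x = cell y \<Longrightarrow> \<bar>f x - f y\<bar> \<le> w"
  shows "(\<integral>\<^sup>+X. ennreal (\<Prod>i<l. if first_hit cell X i
             then exp (- (s\<^sup>2 * w\<^sup>2 / 2)) * exp (s * (f (X i) - stratum_mean f (cell (X i)))) else 1) \<partial>samples l) \<le> 1"
proof -
  let ?first = "\<lambda>\<sigma> i. first_hit (\<lambda>k. k) \<sigma> i"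
  define h where "h \<sigma> i x = (if ?first \<sigma> i
      then ennreal (exp (- (s\<^sup>2 * w\<^sup>2 / 2))) * ennreal (exp (s * (f x - stratum_mean f (\<sigma> i)))) else 1)"
    for \<sigma> :: "nat \<Rightarrow> 'k" and i x
  have "(\<integral>\<^sup>+X. (\<Prod>i<l. h (\<lambda>i\<in>{..<l}. cell (X i)) i (X i)) \<partial>samples l) \<le> 1"
  proof (rule nn_integral_cell_pattern_prod_le)
    show "h \<sigma> i \<in> borel_measurable M" for \<sigma> i
      unfolding h_def using f by measurable
  next
    fix \<sigma> :: "nat \<Rightarrow> 'k" and i
    assume "\<sigma> \<in> {..<l} \<rightarrow>\<^sub>E K" "i < l"
    then have k: "\<sigma> i \<in> K" by auto
    show "(\<integral>\<^sup>+x. h \<sigma> i x * indicator (stratum (\<sigma> i)) x \<partial>M) \<le> emeasure M (stratum (\<sigma> i))"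
    proof (cases "?first \<sigma> i")
      case True
      let ?e = "\<lambda>x. ennreal (exp (s * (f x - stratum_mean f (\<sigma> i)))) * indicator (stratum (\<sigma> i)) x"
      have "?e \<in> borel_measurable M"
        using f by measurable
      then have "(\<integral>\<^sup>+x. h \<sigma> i x * indicator (stratum (\<sigma> i)) x \<partial>M)
              = ennreal (exp (- (s\<^sup>2 * w\<^sup>2 / 2))) * (\<integral>\<^sup>+x. ?e x \<partial>M)"
        using True by (simp add: h_def mult.assoc nn_integral_cmult)
      also have "\<dots> \<le> ennreal (exp (- (s\<^sup>2 * w\<^sup>2 / 2))) * (ennreal (exp (s\<^sup>2 * w\<^sup>2 / 2)) * emeasure M (stratum (\<sigma> i)))"
        by (intro mult_left_mono nn_integral_stratum_exp_le f \<open>s > 0\<close> k osc) auto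
      also have "\<dots> = emeasure M (stratum (\<sigma> i))"
        by (simp add: mult.assoc[symmetric] flip: ennreal_mult exp_add)
      finally show ?thesis .
    qed (simp add: h_def)
  qed
  moreover have "(\<Prod>i<l. h (\<lambda>i\<in>{..<l}. cell (X i)) i (X i))
      = ennreal (\<Prod>i<l. if first_hit cell X i
             then exp (- (s\<^sup>2 * w\<^sup>2 / 2)) * exp (s * (f (X i) - stratum_mean f (cell (X i)))) else 1)" for X
  proof -
    \<comment> \<open>Restricting the pattern to indices below \<open>l\<close> is harmless, since
      the test at \<open>i\<close> looks at no index beyond \<open>i\<close>.\<close>
    have "?first (\<lambda>i\<in>{..<l}. cell (X i)) i \<longleftrightarrow> first_hit cell X i" if "i < l" for i
      using that by (intro first_hit_cong) simp
    then have "h (\<lambda>i\<in>{..<l}. cell (X i)) i (X i) = ennreal (if first_hit cell X i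
             then exp (- (s\<^sup>2 * w\<^sup>2 / 2)) * exp (s * (f (X i) - stratum_mean f (cell (X i)))) else 1)" if "i < l" for i
      using that by (simp add: h_def ennreal_mult)
    then show ?thesis
      by (subst prod_ennreal[symmetric]) auto
  qed
  ultimately show ?thesis by simp
qed

lemma card_first_hits_le:
  assumes "X \<in> space (samples l)"
  shows "card {i. i < l \<and> first_hit cell X i} \<le> card K"
proof (rule card_inj_on_le[OF _ _ finite_K])
  show "inj_on (\<lambda>i. cell (X i)) {i. i < l \<and> first_hit cell X i}"
    by (rule inj_on_subset[OF inj_on_first_hits]) auto
  show "(\<lambda>i. cell (X i)) ` {i. i < l \<and> first_hit cell X i} \<subseteq> K"
    using assms by (auto intro!: cell_in_K space_samples)
qed

text \<open>The exponential Markov inequality: on the event the normalised product is at least the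
  reciprocal of the claimed bound, while its expectation is at most 1.\<close>

lemma centred_hit_sum_tail:
  fixes f :: "'a \<Rightarrow> real" and w t :: real
  assumes f: "f \<in> borel_measurable M" and "w > 0" "t > 0"
    and osc: "\<And>x y. x \<in> space M \<Longrightarrow> y \<in> space M \<Longrightarrow> cell x = cell y \<Longrightarrow> \<bar>f x - f y\<bar> \<le> w"
  shows "measure (samples l) {X \<in> space (samples l). centred_hit_sum f l X \<ge> card K * t}
           \<le> exp (- (card K * t\<^sup>2 / (2 * w\<^sup>2)))"
proof -
  \<comment> \<open>The maximiser of \<open>s * t - s\<^sup>2 * w\<^sup>2 / 2\<close>; the maximum
    is \<open>t\<^sup>2 / (2 * w\<^sup>2)\<close>.\<close>
  define s where "s = t / w\<^sup>2"
  have s: "s > 0"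
    using assms by (simp add: s_def)
  define b where "b = s\<^sup>2 * w\<^sup>2 / 2"
  let ?P = "\<lambda>X. \<Prod>i<l. if first_hit cell X i
      then exp (- b) * exp (s * (f (X i) - stratum_mean f (cell (X i)))) else 1"
  let ?B = "{X \<in> space (samples l). centred_hit_sum f l X \<ge> card K * t}"
  let ?c = "exp (- (card K * t\<^sup>2 / (2 * w\<^sup>2)))"
  have B: "?B \<in> sets (samples l)"
    using measurable_centred_hit_sum[OF f, of l] by measurable
  have P_nonneg: "0 \<le> ?P X" for X
    by (intro prod_nonneg) auto
  have mean: "(\<lambda>x. stratum_mean f (cell x)) \<in> borel_measurable M"
    by (rule measurable_compose[OF measurable_cell]) simp
  have e: "(\<lambda>x. exp (- b) * exp (s * (f x - stratum_mean f (cell x)))) \<in> borel_measurable M"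
    using f mean by measurable
  have P_measurable: "?P \<in> borel_measurable (samples l)"
    using e measurable_first_hit[unfolded pred_def]
    by (intro borel_measurable_prod measurable_If borel_measurable_const measurable_sample[OF e]) auto
  have key: "1 \<le> ?c * ?P X" if X: "X \<in> ?B" for X
  proof -
    let ?F = "{i. i < l \<and> first_hit cell X i}"
    have sum: "centred_hit_sum f l X = (\<Sum>i\<in>?F. f (X i) - stratum_mean f (cell (X i)))"
      unfolding centred_hit_sum_def by (simp add: sum.If_cases Int_def)
    have "?P X = (\<Prod>i\<in>?F. exp (- b) * exp (s * (f (X i) - stratum_mean f (cell (X i)))))"
      by (simp add: prod.If_cases Int_def)
    also have "\<dots> = exp (- b) ^ card ?F * exp (s * centred_hit_sum f l X)"
      by (simp add: prod.distrib sum sum_distrib_left flip: exp_sum)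
    also have "\<dots> = exp (s * centred_hit_sum f l X - card ?F * b)"
      by (simp add: exp_diff exp_minus exp_of_nat_mult[symmetric] field_simps power_inverse)
    finally have P: "?P X = exp (s * centred_hit_sum f l X - card ?F * b)" .
    \<comment> \<open>The random number of first hits is replaced by its upper bound
      \<open>card K\<close>, as \<open>b\<close> is nonnegative.\<close>
    have "card ?F * b \<le> card K * b"
      using X card_first_hits_le[of X l] by (intro mult_right_mono) (auto simp: b_def)
    moreover have "s * (card K * t) \<le> s * centred_hit_sum f l X"
      using X s by (intro mult_left_mono) auto
    moreover have "s * (card K * t) - card K * b = card K * t\<^sup>2 / (2 * w\<^sup>2)"
      using \<open>w > 0\<close> by (simp add: s_def b_def field_simps power2_eq_square)
    ultimately have "0 \<le> - (card K * t\<^sup>2 / (2 * w\<^sup>2)) + (s * centred_hit_sum f l X - card ?F * b)"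
      by linarith
    then show ?thesis
      unfolding P by (simp flip: exp_add)
  qed
  have "emeasure (samples l) ?B = (\<integral>\<^sup>+X. indicator ?B X \<partial>samples l)"
    using B by simp
  also have "\<dots> \<le> (\<integral>\<^sup>+X. ennreal ?c * ennreal (?P X) \<partial>samples l)"
  proof (rule nn_integral_mono)
    fix X
    show "indicator ?B X \<le> ennreal ?c * ennreal (?P X)"
    proof (cases "X \<in> ?B")
      case True
      then show ?thesis
        using key[OF True] P_nonneg[of X] by (simp flip: ennreal_mult ennreal_1 add: ennreal_leI)
    qed simp
  qed
  also have "\<dots> = ennreal ?c * (\<integral>\<^sup>+X. ennreal (?P X) \<partial>samples l)"
    by (rule nn_integral_cmult) (use P_measurable in measurable)
  also have "\<dots> \<le> ennreal ?c * 1"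
    unfolding b_def by (intro mult_left_mono nn_integral_first_hits_le f s osc) auto
  finally show ?thesis
    by (simp add: measure_def enn2real_leI)
qed


lemma stratum_mean_uminus: "stratum_mean (\<lambda>x. - f x) k = - stratum_mean f k"
  by (simp add: stratum_mean_def)

text \<open>Turns the lower tail for \<open>f\<close> into the upper tail for its negative.\<close>

lemma centred_hit_sum_uminus: "centred_hit_sum (\<lambda>x. - f x) l X = - centred_hit_sum f l X"
proof -
  have "centred_hit_sum (\<lambda>x. - f x) l X
      = (\<Sum>i<l. - (if first_hit cell X i then f (X i) - stratum_mean f (cell (X i)) else 0))"
    unfolding centred_hit_sum_def by (rule sum.cong) (auto simp: stratum_mean_uminus)
  then show ?thesis
    by (simp add: centred_hit_sum_def sum_negf)
qed

section \<open>Missed strata and concentration of the estimator\<close>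

definition hit_sum :: "('a \<Rightarrow> real) \<Rightarrow> nat \<Rightarrow> (nat \<Rightarrow> 'a) \<Rightarrow> real" where
  "hit_sum f l X = (\<Sum>i<l. if first_hit cell X i then f (X i) else 0)"

lemma measurable_hit_sum:
  assumes "f \<in> borel_measurable M"
  shows "hit_sum f l \<in> borel_measurable (samples l)"
proof -
  have "(\<lambda>X. if first_hit cell X i then f (X i) else 0) \<in> borel_measurable (samples l)" if "i < l" for i
    using that assms measurable_first_hit[OF that, unfolded pred_def]
    by (intro measurable_If measurable_sample[of f] borel_measurable_const)
  then show ?thesis
    unfolding hit_sum_def by (intro borel_measurable_sum) auto
qed

definition missed :: "nat \<Rightarrow> 'k \<Rightarrow> (nat \<Rightarrow> 'a) set" where
  "missed l k = {X \<in> space (samples l). \<forall>i<l. cell (X i) \<noteq> k}"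

text \<open>If no stratum is missed, the first hits pick each stratum exactly once, so the
  subtracted means add up to the sum of all stratum means.\<close>

lemma hit_sum_eq:
  assumes f: "integrable M f" and X: "X \<in> space (samples l)" and hit: "\<And>k. k \<in> K \<Longrightarrow> X \<notin> missed l k"
  shows "hit_sum f l X = centred_hit_sum f l X + card K * expectation f"
proof -
  let ?F = "{i. i < l \<and> first_hit cell X i}"
  have "K = (\<lambda>i. cell (X i)) ` {..<l}"
    using X hit by (fastforce simp: missed_def intro: cell_in_K space_samples)
  then have K: "K = (\<lambda>i. cell (X i)) ` ?F"
    by (simp only: image_first_hits)
  have inj: "inj_on (\<lambda>i. cell (X i)) ?F"
    by (rule inj_on_subset[OF inj_on_first_hits]) auto
  have "hit_sum f l X - centred_hit_sum f l X = (\<Sum>i<l. if first_hit cell X i then stratum_mean f (cell (X i)) else 0)"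
    unfolding hit_sum_def centred_hit_sum_def sum_subtractf[symmetric] by (intro sum.cong) auto
  also have "\<dots> = (\<Sum>i\<in>?F. stratum_mean f (cell (X i)))"
    by (simp add: sum.If_cases Int_def)
  also have "\<dots> = (\<Sum>k\<in>K. stratum_mean f k)"
    using inj by (subst K) (simp add: sum.reindex o_def)
  finally show ?thesis
    by (simp add: sum_stratum_mean[OF f])
qed

text \<open>The event is a product set, which yields both its measurability and its
  probability.\<close>

lemma missed_eq: "missed l k = ({..<l} \<rightarrow>\<^sub>E (space M - stratum k))"
proof (rule set_eqI)
  fix X
  show "X \<in> missed l k \<longleftrightarrow> X \<in> ({..<l} \<rightarrow>\<^sub>E (space M - stratum k))"
    unfolding missed_def space_PiM stratum_def PiE_iff mem_Collect_eq Diff_iff by blast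
qed

lemma sets_missed: "missed l k \<in> sets (samples l)"
  unfolding missed_eq by (intro sets_PiM_I_finite) auto

text \<open>By independence the probability is \<open>(1 - 1 / card K) ^ l\<close>, and
  \<open>1 + u \<le> exp u\<close>.\<close>

lemma measure_missed_le:
  assumes k: "k \<in> K"
  shows "measure (samples l) (missed l k) \<le> exp (- (l / card K))"
proof -
  interpret P: finite_product_prob_space "\<lambda>_::nat. M" "{..<l}"
    by unfold_locales auto
  have "measure (samples l) (missed l k) = (\<Prod>i<l. prob (space M - stratum k))"
    unfolding missed_eq by (rule P.prob_times) auto
  also have "\<dots> = (1 - 1 / card K) ^ l"
    using prob_cell[OF k] by (simp add: prob_compl flip: stratum_def)
  also have "\<dots> \<le> exp (- (1 / card K)) ^ l"
    using card_K_pos exp_ge_add_one_self[of "- (1 / card K)"] by (intro power_mono) auto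
  also have "\<dots> = exp (- (l / card K))"
    by (simp flip: exp_of_nat_mult)
  finally show ?thesis .
qed

text \<open>A union bound over three bad events: the two tails of the centred sum, and some stratum
  being missed. Off these events the error is the centred sum divided by
  \<open>card K\<close>.\<close>

theorem hit_sum_concentration:
  fixes f :: "'a \<Rightarrow> real" and w t :: real
  assumes f: "integrable M f" and w: "w > 0" and t: "t > 0"
    and osc: "\<And>x y. x \<in> space M \<Longrightarrow> y \<in> space M \<Longrightarrow> cell x = cell y \<Longrightarrow> \<bar>f x - f y\<bar> \<le> w"
  shows "measure (samples l) {X \<in> space (samples l). \<bar>expectation f - hit_sum f l X / card K\<bar> \<le> t}
           \<ge> 1 - (2 * exp (- (card K * t\<^sup>2 / (2 * w\<^sup>2))) + card K * exp (- (l / card K)))"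
proof -
  interpret P: product_prob_space "\<lambda>_::nat. M" "{..<l}"
    by (rule product_prob_spaceI) (rule prob_space_axioms)
  have [measurable]: "f \<in> borel_measurable M"
    using f by simp
  let ?upper = "{X \<in> space (samples l). centred_hit_sum f l X \<ge> card K * t}"
  let ?lower = "{X \<in> space (samples l). centred_hit_sum (\<lambda>x. - f x) l X \<ge> card K * t}"
  let ?missed = "\<Union>k\<in>K. missed l k"
  let ?good = "{X \<in> space (samples l). \<bar>expectation f - hit_sum f l X / card K\<bar> \<le> t}"
  let ?e = "exp (- (card K * t\<^sup>2 / (2 * w\<^sup>2)))"
  have meas: "hit_sum f l \<in> borel_measurable (samples l)"
      "centred_hit_sum f l \<in> borel_measurable (samples l)"
      "centred_hit_sum (\<lambda>x. - f x) l \<in> borel_measurable (samples l)"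
    by (intro measurable_hit_sum measurable_centred_hit_sum; simp)+
  have sets: "?upper \<in> sets (samples l)" "?lower \<in> sets (samples l)" "?good \<in> sets (samples l)"
    using meas by measurable
  have missed: "?missed \<in> sets (samples l)"
    using finite_K sets_missed by (intro sets.finite_UN) auto
  have "measure (samples l) ?upper \<le> ?e"
    by (rule centred_hit_sum_tail) (use w t osc in auto)
  moreover have "measure (samples l) ?lower \<le> ?e"
    by (rule centred_hit_sum_tail) (use w t osc in \<open>auto simp: abs_minus_commute\<close>)
  moreover have "measure (samples l) ?missed \<le> card K * exp (- (l / card K))"
  proof -
    have "measure (samples l) ?missed \<le> (\<Sum>k\<in>K. measure (samples l) (missed l k))"
      using finite_K sets_missed by (intro P.finite_measure_subadditive_finite) auto
    also have "\<dots> \<le> (\<Sum>k\<in>K. exp (- (l / card K)))"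
      by (intro sum_mono measure_missed_le)
    finally show ?thesis by simp
  qed
  moreover have "measure (samples l) (?upper \<union> ?lower \<union> ?missed)
      \<le> measure (samples l) ?upper + measure (samples l) ?lower + measure (samples l) ?missed"
    using sets missed
    by (intro order_trans[OF measure_Un_le] add_right_mono measure_Un_le) auto
  moreover have "1 - measure (samples l) (?upper \<union> ?lower \<union> ?missed) \<le> measure (samples l) ?good"
  proof -
    have "\<bar>expectation f - hit_sum f l X / card K\<bar> \<le> t"
      if X: "X \<in> space (samples l)" and bad: "X \<notin> ?upper \<union> ?lower \<union> ?missed" for X
    proof -
      have "hit_sum f l X = centred_hit_sum f l X + card K * expectation f"
        using f X bad by (intro hit_sum_eq) auto
      then have "expectation f - hit_sum f l X / card K = - (centred_hit_sum f l X / card K)"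
        using card_K_pos by (simp add: field_simps)
      moreover have "\<bar>centred_hit_sum f l X\<bar> \<le> card K * t"
        using X bad by (auto simp: centred_hit_sum_uminus)
      ultimately show ?thesis
        using card_K_pos by (simp add: abs_divide pos_divide_le_eq mult.commute)
    qed
    then have "space (samples l) - (?upper \<union> ?lower \<union> ?missed) \<subseteq> ?good"
      by blast
    then have "measure (samples l) (space (samples l) - (?upper \<union> ?lower \<union> ?missed)) \<le> measure (samples l) ?good"
      using sets by (intro P.finite_measure_mono) auto
    then show ?thesis
      using sets missed by (simp add: P.prob_compl)
  qed
  ultimately show ?thesis by linarith
qed

end

subsection \<open>The grid on the unit square\<close>

text \<open>The minimum puts the edge \<open>u = 1\<close> into the last cell.\<close>

definition grid_index :: "nat \<Rightarrow> real \<Rightarrow> nat" where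
  "grid_index N u = min (N - 1) (nat \<lfloor>N * u\<rfloor>)"

definition grid_cell :: "nat \<Rightarrow> real \<times> real \<Rightarrow> nat \<times> nat" where
  "grid_cell N x = (grid_index N (fst x), grid_index N (snd x))"

abbreviation uniform_square :: "(real \<times> real) measure" where
  "uniform_square \<equiv> restrict_space lborel unit_square"

lemma grid_index_less: "N > 0 \<Longrightarrow> grid_index N u < N"
  by (auto simp: grid_index_def)

lemma grid_index_bounds:
  assumes "N > 0" "0 \<le> u" "u \<le> 1"
  shows "grid_index N u / N \<le> u" "u \<le> (real (grid_index N u) + 1) / N"
proof -
  have nonneg: "0 \<le> N * u" using assms by simp
  have "real (grid_index N u) \<le> real (nat \<lfloor>N * u\<rfloor>)"
    by (simp add: grid_index_def)
  also have "\<dots> \<le> N * u"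
    using nonneg by (simp add: of_nat_floor)
  finally show "grid_index N u / N \<le> u"
    using assms by (simp add: field_simps)
  \<comment> \<open>Covers the case in which the minimum in \<open>grid_index\<close> is
    \<open>N - 1\<close>, in particular \<open>u = 1\<close>.\<close>
  have "N * u \<le> real (N - 1) + 1"
    using assms by (simp add: mult_left_le)
  moreover have "N * u \<le> real (nat \<lfloor>N * u\<rfloor>) + 1"
    by linarith
  ultimately have "N * u \<le> real (grid_index N u) + 1"
    by (auto simp: grid_index_def min_def)
  then show "u \<le> (real (grid_index N u) + 1) / N"
    using assms by (simp add: field_simps)
qed

text \<open>Covers the interior of a cell, which already carries its full measure.\<close>

lemma grid_index_eqI:
  assumes "i < N" "i / N < u" "u < (real i + 1) / N"
  shows "grid_index N u = i"
proof -
  have "real i < N * u" "N * u < real i + 1"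
    using assms by (simp_all add: field_simps)
  then have "\<lfloor>N * u\<rfloor> = int i"
    by linarith
  then show ?thesis
    using assms by (simp add: grid_index_def)
qed

section \<open>The uniform law on the square and the measure of grid cells\<close>

lemma unit_square_eq_cbox: "unit_square = cbox (0, 0) (1, 1)"
  by (simp add: unit_square_def cbox_Pair_eq)

lemma space_uniform_square [simp]: "space uniform_square = unit_square"
  by (simp add: space_restrict_space)

lemma sets_unit_square [measurable, simp]: "unit_square \<in> sets borel"
  by (simp add: unit_square_eq_cbox)

lemma measure_uniform_square:
  "A \<subseteq> unit_square \<Longrightarrow> measure uniform_square A = measure lborel A"
  by (intro measure_restrict_space) auto

lemma prob_space_uniform_square: "prob_space uniform_square"
proof (rule prob_spaceI)
  have "emeasure lborel unit_square = 1"
    by (simp add: unit_square_eq_cbox emeasure_lborel_cbox_eq Basis_prod_def)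
  then show "emeasure uniform_square (space uniform_square) = 1"
    by (simp add: emeasure_restrict_space)
qed

lemma sets_grid_cell: "{x \<in> unit_square. grid_cell N x = k} \<in> sets borel"
proof -
  have idx: "grid_index N \<in> measurable borel (count_space UNIV)"
    unfolding grid_index_def by measurable
  have "(\<lambda>x :: real \<times> real. grid_index N (fst x)) \<in> measurable borel (count_space UNIV)"
    by (rule measurable_compose[OF _ idx]) (intro borel_measurable_continuous_onI continuous_intros)
  then have "(\<lambda>x :: real \<times> real. grid_index N (fst x)) -` {fst k} \<inter> space borel \<in> sets borel"
    by (rule measurable_sets) simp
  moreover have "(\<lambda>x :: real \<times> real. grid_index N (snd x)) \<in> measurable borel (count_space UNIV)"
    by (rule measurable_compose[OF _ idx]) (intro borel_measurable_continuous_onI continuous_intros)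
  then have "(\<lambda>x :: real \<times> real. grid_index N (snd x)) -` {snd k} \<inter> space borel \<in> sets borel"
    by (rule measurable_sets) simp
  moreover have "{x \<in> unit_square. grid_cell N x = k}
      = unit_square \<inter> ((\<lambda>x. grid_index N (fst x)) -` {fst k} \<inter> space borel)
          \<inter> ((\<lambda>x. grid_index N (snd x)) -` {snd k} \<inter> space borel)"
    by (auto simp: grid_cell_def prod_eq_iff)
  ultimately show ?thesis
    by (simp only: sets.Int sets_unit_square)
qed

text \<open>The cell lies between an open and a closed box of the same area, so the assignment of
  boundary points does not affect its measure.\<close>

lemma measure_grid_cell:
  assumes ij: "i < N" "j < N"
  shows "measure lborel {x \<in> unit_square. grid_cell N x = (i, j)} = 1 / (real N)\<^sup>2"
proof (rule antisym)
  let ?C = "{x \<in> unit_square. grid_cell N x = (i, j)}"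
  let ?a = "(i / N, j / N)" and ?b = "((real i + 1) / N, (real j + 1) / N)"
  have N: "N > 0" using ij by simp
  have C: "?C \<in> sets lborel"
    using sets_grid_cell by simp
  have le: "i / N \<le> (real i + 1) / N" "j / N \<le> (real j + 1) / N"
    using N by (simp_all add: field_simps)
  have side: "(real i + 1) / N - i / N = 1 / N" "(real j + 1) / N - j / N = 1 / N"
    by (simp_all add: diff_divide_distrib[symmetric])
  have cbox: "measure lborel (cbox ?a ?b) = 1 / (real N)\<^sup>2"
    using le by (simp add: measure_lborel_cbox_eq Basis_prod_def side power2_eq_square)
  have box: "measure lborel (box ?a ?b) = 1 / (real N)\<^sup>2"
    using le by (simp add: measure_lborel_box_eq Basis_prod_def side power2_eq_square)
  have "?C \<subseteq> cbox ?a ?b"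
    using grid_index_bounds[OF N]
    by (auto simp: unit_square_def grid_cell_def cbox_Pair_eq)
  then have "measure lborel ?C \<le> measure lborel (cbox ?a ?b)"
    using C by (intro measure_mono_fmeasurable) auto
  then show "measure lborel ?C \<le> 1 / (real N)\<^sup>2"
    by (simp only: cbox)
  have "box ?a ?b \<subseteq> ?C"
  proof
    fix x assume "x \<in> box ?a ?b"
    then have x: "i / N < fst x" "fst x < (real i + 1) / N" "j / N < snd x" "snd x < (real j + 1) / N"
      by (auto simp: box_def Basis_prod_def inner_prod_def)
    moreover have "(real i + 1) / N \<le> 1" "(real j + 1) / N \<le> 1" "0 \<le> i / N" "0 \<le> j / N"
      using ij N by (auto simp: field_simps)
    ultimately have "0 \<le> fst x" "fst x \<le> 1" "0 \<le> snd x" "snd x \<le> 1"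
      by linarith+
    then show "x \<in> ?C"
      using x ij by (cases x) (auto simp: unit_square_def grid_cell_def intro!: grid_index_eqI)
  qed
  moreover have "?C \<in> fmeasurable lborel"
    by (rule fmeasurableI2[of "cbox ?a ?b"]) (use C \<open>?C \<subseteq> cbox ?a ?b\<close> in auto)
  ultimately have "measure lborel (box ?a ?b) \<le> measure lborel ?C"
    by (intro measure_mono_fmeasurable) auto
  then show "1 / (real N)\<^sup>2 \<le> measure lborel ?C"
    by (simp only: box)
qed

lemma equal_stratification_grid:
  assumes N: "N > 0"
  shows "equal_stratification uniform_square (grid_cell N) ({..<N} \<times> {..<N})"
proof -
  interpret prob_space uniform_square
    by (rule prob_space_uniform_square)
  have cell: "grid_cell N x \<in> {..<N} \<times> {..<N}" for x
    using grid_index_less[OF N] by (simp add: grid_cell_def)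
  have sets: "grid_cell N -` {k} \<inter> unit_square \<in> sets uniform_square" for k
  proof -
    have "grid_cell N -` {k} \<inter> unit_square = {x \<in> unit_square. grid_cell N x = k}"
      by auto
    also have "\<dots> \<in> sets borel"
      by (rule sets_grid_cell)
    finally show ?thesis
      by (simp add: sets_restrict_space_iff)
  qed
  show ?thesis
  proof
    show "grid_cell N \<in> measurable uniform_square (count_space ({..<N} \<times> {..<N}))"
      using cell sets by (subst measurable_count_space_eq2) auto
    show "prob {x \<in> space uniform_square. grid_cell N x = k} = 1 / card ({..<N} \<times> {..<N})"
      if "k \<in> {..<N} \<times> {..<N}" for k
    proof -
      have "prob {x \<in> space uniform_square. grid_cell N x = k}
          = measure lborel {x \<in> unit_square. grid_cell N x = (fst k, snd k)}"
        by (simp add: measure_uniform_square)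
      also have "\<dots> = 1 / (real N)\<^sup>2"
        using that by (intro measure_grid_cell) auto
      finally show ?thesis
        by (simp add: card_cartesian_product power2_eq_square)
    qed
  qed (use N in auto)
qed

section \<open>Oscillation and integrability of mixed Hoelder functions\<close>

text \<open>Change one coordinate at a time, passing through \<open>(fst y, snd x)\<close>.\<close>

lemma mixed_holder_diff_le:
  assumes "mixed_holder c \<alpha> f" "x \<in> unit_square" "y \<in> unit_square"
  shows "\<bar>f x - f y\<bar> \<le> c * \<bar>fst x - fst y\<bar> powr \<alpha> + c * \<bar>snd x - snd y\<bar> powr \<alpha>"
proof -
  have "\<bar>f (fst x, snd x) - f (fst y, snd x)\<bar> \<le> c * \<bar>fst x - fst y\<bar> powr \<alpha>"
      "\<bar>f (fst y, snd x) - f (fst y, snd y)\<bar> \<le> c * \<bar>snd x - snd y\<bar> powr \<alpha>"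
    using assms unfolding mixed_holder_def unit_square_def mem_Times_iff by blast+
  then show ?thesis by simp
qed

lemma mixed_holder_diff_le_const:
  assumes "mixed_holder c \<alpha> f" "x \<in> unit_square" "y \<in> unit_square" "c \<ge> 0" "\<alpha> \<ge> 0"
    and "\<bar>fst x - fst y\<bar> \<le> r" "\<bar>snd x - snd y\<bar> \<le> r"
  shows "\<bar>f x - f y\<bar> \<le> 2 * c * r powr \<alpha>"
proof -
  have "c * \<bar>fst x - fst y\<bar> powr \<alpha> \<le> c * r powr \<alpha>" "c * \<bar>snd x - snd y\<bar> powr \<alpha> \<le> c * r powr \<alpha>"
    using assms by (auto intro!: mult_left_mono powr_mono2)
  then show ?thesis
    using mixed_holder_diff_le[OF assms(1-3)] by simp
qed

lemma mixed_holder_osc_le: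
  assumes "mixed_holder c \<alpha> f" "x \<in> unit_square" "y \<in> unit_square" "c \<ge> 0" "\<alpha> \<ge> 0"
  shows "\<bar>f x - f y\<bar> \<le> 2 * c"
proof -
  have "\<bar>fst x - fst y\<bar> \<le> 1" "\<bar>snd x - snd y\<bar> \<le> 1"
    using assms(2,3) by (auto simp: unit_square_def mem_Times_iff)
  then show ?thesis
    using mixed_holder_diff_le_const[OF assms, of 1] by simp
qed

text \<open>Serves to make \<open>f\<close> measurable on the square.\<close>

lemma mixed_holder_continuous_on:
  assumes "mixed_holder c \<alpha> f" "\<alpha> > 0"
  shows "continuous_on unit_square f"
  unfolding continuous_on_def
proof
  fix x assume x: "x \<in> unit_square"
  have "((\<lambda>y. f y - f x) \<longlongrightarrow> 0) (at x within unit_square)"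
  proof (rule Lim_null_comparison)
    show "\<forall>\<^sub>F y in at x within unit_square.
        norm (f y - f x) \<le> c * \<bar>fst y - fst x\<bar> powr \<alpha> + c * \<bar>snd y - snd x\<bar> powr \<alpha>"
      using mixed_holder_diff_le[OF assms(1) _ x] by (auto simp: eventually_at_filter)
    have "((\<lambda>y. \<bar>fst y - fst x\<bar> powr \<alpha>) \<longlongrightarrow> 0) (at x within unit_square)"
        "((\<lambda>y. \<bar>snd y - snd x\<bar> powr \<alpha>) \<longlongrightarrow> 0) (at x within unit_square)"
      using \<open>\<alpha> > 0\<close>
      by (auto intro!: tendsto_zero_powrI tendsto_const tendsto_rabs_zero tendsto_eq_intros)
    then show "((\<lambda>y. c * \<bar>fst y - fst x\<bar> powr \<alpha> + c * \<bar>snd y - snd x\<bar> powr \<alpha>) \<longlongrightarrow> 0)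
        (at x within unit_square)"
      by (intro tendsto_add_zero tendsto_mult_right_zero)
  qed
  then show "(f \<longlongrightarrow> f x) (at x within unit_square)"
    by (rule LIM_zero_cancel)
qed

lemma mixed_holder_integrable:
  assumes "mixed_holder c \<alpha> f" "\<alpha> > 0" "c \<ge> 0"
  shows "integrable uniform_square f"
proof -
  interpret prob_space uniform_square
    by (rule prob_space_uniform_square)
  have "sets uniform_square = sets (restrict_space borel unit_square)"
    by (simp add: sets_restrict_space)
  then have "f \<in> borel_measurable uniform_square"
    using borel_measurable_continuous_on_restrict[OF mixed_holder_continuous_on[OF assms(1,2)]]
    by (simp cong: measurable_cong_sets)
  moreover have "\<bar>f x\<bar> \<le> \<bar>f (0, 0)\<bar> + 2 * c" if "x \<in> unit_square" for x
    using mixed_holder_osc_le[OF assms(1) that, of "(0, 0)"] assms by (simp add: unit_square_def)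
  ultimately show ?thesis
    by (intro integrable_const_bound[of _ "\<bar>f (0, 0)\<bar> + 2 * c"]) (auto intro!: AE_I2)
qed

lemma set_integral_unit_square: "(LINT x:unit_square|lborel. f x) = integral\<^sup>L uniform_square f"
  for f :: "real \<times> real \<Rightarrow> real"
  unfolding set_lebesgue_integral_def by (subst integral_restrict_space) auto

text \<open>The difference quotient at \<open>x\<close> is bounded by
  \<open>c * \<bar>y - x\<bar> powr (\<alpha> - 1)\<close>, which tends to 0, so the derivative
  vanishes on the whole interval.\<close>

lemma holder_gt_1_imp_constant:
  fixes g :: "real \<Rightarrow> real"
  assumes "\<alpha> > 1" and g: "\<And>s t. s \<in> {0..1} \<Longrightarrow> t \<in> {0..1} \<Longrightarrow> \<bar>g s - g t\<bar> \<le> c * \<bar>s - t\<bar> powr \<alpha>"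
    and "s \<in> {0..1}" "t \<in> {0..1}"
  shows "g s = g t"
proof -
  have "(g has_field_derivative 0) (at x within {0..1})" if x: "x \<in> {0..1}" for x
    unfolding has_field_derivative_iff
  proof (rule Lim_null_comparison)
    show "\<forall>\<^sub>F y in at x within {0..1}. norm ((g y - g x) / (y - x)) \<le> c * \<bar>y - x\<bar> powr (\<alpha> - 1)"
      unfolding eventually_at_filter
    proof (intro always_eventually allI impI)
      fix y assume y: "y \<noteq> x" "y \<in> {0..1}"
      have "\<bar>g y - g x\<bar> \<le> c * \<bar>y - x\<bar> powr (\<alpha> - 1) * \<bar>y - x\<bar>"
        using g[OF y(2) x] y(1) by (simp add: powr_diff)
      then show "norm ((g y - g x) / (y - x)) \<le> c * \<bar>y - x\<bar> powr (\<alpha> - 1)"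
        using y(1) by (simp add: abs_divide pos_divide_le_eq)
    qed
    have "((\<lambda>y. \<bar>y - x\<bar> powr (\<alpha> - 1)) \<longlongrightarrow> 0) (at x within {0..1})"
      using \<open>\<alpha> > 1\<close>
      by (auto intro!: tendsto_zero_powrI tendsto_const tendsto_rabs_zero tendsto_eq_intros)
    then show "((\<lambda>y. c * \<bar>y - x\<bar> powr (\<alpha> - 1)) \<longlongrightarrow> 0) (at x within {0..1})"
      by (rule tendsto_mult_right_zero)
  qed
  then obtain d where "\<And>x. x \<in> {0..1} \<Longrightarrow> g x = d"
    using has_field_derivative_zero_constant[of "{0..1}" g] by auto
  then show ?thesis
    using assms by simp
qed

lemma mixed_holder_gt_1_constant:
  assumes f: "mixed_holder c \<alpha> f" and "\<alpha> > 1" "x \<in> unit_square" "y \<in> unit_square"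
  shows "f x = f y"
proof -
  have "f (fst x, snd x) = f (fst y, snd x)"
    by (rule holder_gt_1_imp_constant[of \<alpha> "\<lambda>u. f (u, snd x)" c])
       (use assms in \<open>auto simp: mixed_holder_def unit_square_def\<close>)
  also have "\<dots> = f (fst y, snd y)"
    by (rule holder_gt_1_imp_constant[of \<alpha> "\<lambda>u. f (fst y, u)" c])
       (use assms in \<open>auto simp: mixed_holder_def unit_square_def\<close>)
  finally show ?thesis by simp
qed


section \<open>Accuracy of the grid estimator and of a single sample\<close>

text \<open>The concentration bound for \<open>N\<^sup>2\<close> cells of side \<open>1 / N\<close>,
  on which \<open>f\<close> oscillates by at most \<open>w = 2 * c * (1 / N) powr \<alpha>\<close>.
  The exponent is written as half the square of \<open>N * t / w\<close>, so that later only this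
  quotient needs a lower bound.\<close>

lemma grid_estimator_concentration:
  assumes f: "mixed_holder c \<alpha> f" and "\<alpha> > 0" "c > 0" "t > 0" and N: "N > 0"
  shows "\<P>(X in uniform_points l.
           \<bar>(LINT x:unit_square|lborel. f x) - first_hit_sum (grid_cell N) (sample_data f l X) / (real N)\<^sup>2\<bar> \<le> t)
         \<ge> 1 - (2 * exp (- ((N * t / (2 * c * (1 / N) powr \<alpha>))\<^sup>2 / 2)) + (real N)\<^sup>2 * exp (- (l / (real N)\<^sup>2)))"
proof -
  interpret equal_stratification uniform_square "grid_cell N" "{..<N} \<times> {..<N}"
    by (rule equal_stratification_grid[OF N])
  have osc: "\<bar>f x - f y\<bar> \<le> 2 * c * (1 / N) powr \<alpha>"
    if "x \<in> unit_square" "y \<in> unit_square" "grid_cell N x = grid_cell N y" for x y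
  proof -
    have "\<bar>u - v\<bar> \<le> 1 / N" if "u \<in> {0..1}" "v \<in> {0..1}" "grid_index N u = grid_index N v" for u v
      using grid_index_bounds[OF N, of u] grid_index_bounds[OF N, of v] that
      by (simp add: add_divide_distrib abs_le_iff)
    then have "\<bar>fst x - fst y\<bar> \<le> 1 / N" "\<bar>snd x - snd y\<bar> \<le> 1 / N"
      using that by (auto simp: grid_cell_def unit_square_def mem_Times_iff)
    then show ?thesis
      using that assms by (intro mixed_holder_diff_le_const[OF f]) auto
  qed
  have card: "real (card ({..<N} \<times> {..<N})) = (real N)\<^sup>2"
    by (simp add: card_cartesian_product power2_eq_square)
  have w: "2 * c * (1 / N) powr \<alpha> > 0"
    using \<open>c > 0\<close> N by simp
  have exponent: "(real N)\<^sup>2 * t\<^sup>2 / (2 * (2 * c * (1 / N) powr \<alpha>)\<^sup>2)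
      = (N * t / (2 * c * (1 / N) powr \<alpha>))\<^sup>2 / 2"
    by (simp add: power_mult_distrib power_divide)
  have samples: "uniform_points l = samples l"
    by (simp add: uniform_points_def)
  have hit_sum: "hit_sum f l X = first_hit_sum (grid_cell N) (sample_data f l X)" for X
    by (simp add: hit_sum_def first_hit_sum_sample_data)
  have "integrable uniform_square f"
    using assms by (intro mixed_holder_integrable[OF f]) auto
  from hit_sum_concentration[OF this w \<open>t > 0\<close>, of l] osc show ?thesis
    unfolding card exponent samples hit_sum set_integral_unit_square by simp
qed

text \<open>All values of \<open>f\<close>, hence also its mean, lie within \<open>d\<close> of the
  first sampled value. The event is the whole space.\<close>

lemma first_value_error:
  assumes osc: "\<And>x y. x \<in> unit_square \<Longrightarrow> y \<in> unit_square \<Longrightarrow> \<bar>f x - f y\<bar> \<le> d"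
    and f: "integrable uniform_square f" and "l > 0"
  shows "\<P>(X in uniform_points l.
           \<bar>(LINT x:unit_square|lborel. f x) - snd (hd (sample_data f l X))\<bar> \<le> d) = 1"
proof -
  interpret S: prob_space uniform_square
    by (rule prob_space_uniform_square)
  interpret P: prob_space "uniform_points l"
    by (rule prob_space_uniform_points)
  have "\<bar>(LINT x:unit_square|lborel. f x) - snd (hd (sample_data f l X))\<bar> \<le> d"
    if X: "X \<in> space (uniform_points l)" for X
  proof -
    have "X 0 \<in> unit_square"
      using X \<open>l > 0\<close> by (auto simp: uniform_points_def space_PiM)
    then have bounds: "f (X 0) - d \<le> f x" "f x \<le> f (X 0) + d" if "x \<in> unit_square" for x
      using osc[OF that, of "X 0"] by (auto simp: abs_le_iff)
    have "f (X 0) - d \<le> integral\<^sup>L uniform_square f" "integral\<^sup>L uniform_square f \<le> f (X 0) + d"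
      using bounds f by (auto intro!: S.integral_ge_const S.integral_le_const AE_I2)
    moreover have "snd (hd (sample_data f l X)) = f (X 0)"
      using \<open>l > 0\<close> by (simp add: sample_data_def hd_map)
    ultimately show ?thesis
      by (simp add: set_integral_unit_square abs_le_iff)
  qed
  then have "{X \<in> space (uniform_points l).
      \<bar>(LINT x:unit_square|lborel. f x) - snd (hd (sample_data f l X))\<bar> \<le> d} = space (uniform_points l)"
    by blast
  then show ?thesis
    by (simp add: P.prob_space)
qed

section \<open>Choice of the constant and of the estimator\<close>

text \<open>The order of quantifiers matters: \<open>C\<close> is fixed before
  \<open>\<alpha>\<close>, \<open>n\<close> and \<open>l\<close>, and \<open>A\<close> before
  \<open>f\<close>, so \<open>A\<close> learns about \<open>f\<close> only through
  \<open>sample_data\<close>.\<close>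

theorem corollary1p1:
  fixes c c1 :: real
  assumes "c > 0" and "c1 > 0"
  shows "\<exists>C::real. \<forall>(\<alpha>::real) (n::nat) (l::nat).
           \<alpha> > 0 \<longrightarrow> n > 0 \<longrightarrow> real l \<ge> c1 * real n * (ln (real n))\<^sup>2 \<longrightarrow>
           (\<exists>A :: ((real \<times> real) \<times> real) list \<Rightarrow> real.
              \<forall>f :: real \<times> real \<Rightarrow> real. mixed_holder c \<alpha> f \<longrightarrow>
                \<P>(X in uniform_points l.
                    \<bar>(LINT x:unit_square|lborel. f x) - A (sample_data f l X)\<bar>
                      \<le> C * (real n powr (-\<alpha>) * ln (real n) powr (3/2)))
                  \<ge> 1 - real n powr (2 - c1))"
proof -
  \<comment> \<open>The first summand gives \<open>C / (8 * c) \<ge> 3 / 2 * sqrt c1\<close>, which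
    the tail bound for \<open>n \<ge> 3\<close> needs; the second makes the allowed error at least
    \<open>2 * c\<close> for \<open>n = 2\<close>.\<close>
  define C where "C = 12 * c * sqrt c1 + 16 * c"
  have C: "C \<ge> 16 * c" "C \<ge> 12 * c * sqrt c1" "C > 0"
    using assms by (auto simp: C_def add_nonneg_pos)
  show ?thesis
  proof (rule exI[of _ C], intro allI impI)
    fix \<alpha> :: real and n l :: nat
    assume \<alpha>: "\<alpha> > 0" and n: "n > 0" and l: "real l \<ge> c1 * real n * (ln (real n))\<^sup>2"
    define N where "N = nat \<lfloor>sqrt n\<rfloor>"
    define A :: "((real \<times> real) \<times> real) list \<Rightarrow> real" where
      "A = (if \<alpha> > 1 \<or> n = 2 then (\<lambda>xs. snd (hd xs)) else (\<lambda>xs. first_hit_sum (grid_cell N) xs / (real N)\<^sup>2))"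
    let ?t = "C * (real n powr (-\<alpha>) * ln (real n) powr (3/2))"
    have "\<P>(X in uniform_points l. \<bar>(LINT x:unit_square|lborel. f x) - A (sample_data f l X)\<bar> \<le> ?t)
            \<ge> 1 - real n powr (2 - c1)" (is "?p \<ge> _") if f: "mixed_holder c \<alpha> f" for f
    proof -
      \<comment> \<open>In the first case the allowed failure probability is at least 1. In all
        others \<open>n \<ge> 2\<close>, so the number of samples is positive.\<close>
      consider "n = 1 \<or> c1 \<le> 2" | "n \<ge> 2" "c1 > 2" "\<alpha> > 1" | "n = 2" "c1 > 2" "\<alpha> \<le> 1" | "n \<ge> 3" "c1 > 2" "\<alpha> \<le> 1"
        using n by linarith
      then show ?thesis
      proof cases
        case 1
        then have "real n powr (2 - c1) \<ge> 1"
          using n by (auto intro: ge_one_powr_ge_zero)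
        moreover have "?p \<ge> 0" by simp
        ultimately show ?thesis by linarith
      next
        case 2
        have "ln (real n) > 0" using 2 by simp
        then have "c1 * real n * (ln (real n))\<^sup>2 > 0"
          using assms n by simp
        with l have "l > 0" by linarith
        have "\<bar>f x - f y\<bar> \<le> ?t" if "x \<in> unit_square" "y \<in> unit_square" for x y
          using mixed_holder_gt_1_constant[OF f \<open>\<alpha> > 1\<close> that] C by simp
        then have "?p = 1"
          using first_value_error[of f ?t l] mixed_holder_integrable[OF f \<alpha>] assms \<open>l > 0\<close> 2
          by (simp add: A_def)
        then show ?thesis by simp
      next
        case 3
        \<comment> \<open>Separate because \<open>ln 2 < 1\<close>, so powers of \<open>ln n\<close> cannot be compared as for \<open>n \<ge> 3\<close>.\<close>
        have ln2: "1 / 2 \<le> ln (2::real)"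
          using ln_le_minus_one[of "1 / 2 :: real"] by (simp add: ln_div)
        have "c1 * real n * (ln (real n))\<^sup>2 > 0"
          using assms 3 ln2 by simp
        with l have "l > 0" by linarith
        have "1 / 4 \<le> (1 / 2 :: real) powr (3 / 2)"
        proof -
          have "(1 / 2 :: real) powr 2 \<le> (1 / 2) powr (3 / 2)"
            by (rule powr_mono') auto
          then show ?thesis by (simp add: power2_eq_square)
        qed
        also have "\<dots> \<le> ln 2 powr (3 / 2)"
          using ln2 by (intro powr_mono2) auto
        finally have ln_ge: "1 / 4 \<le> ln 2 powr (3 / 2 :: real)" .
        have "2 powr (- \<alpha>) \<ge> (2 :: real) powr (- 1)"
          using 3 by (intro powr_mono) auto
        then have "2 powr (- \<alpha>) \<ge> 1 / (2 :: real)"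
          by (simp add: powr_minus)
        \<comment> \<open>The left side equals \<open>2 * c\<close>, the bound on the oscillation of
          \<open>f\<close> over the whole square.\<close>
        then have "16 * c * (1 / 2 * (1 / 4)) \<le> C * (2 powr (- \<alpha>) * ln 2 powr (3 / 2))"
          using ln_ge C assms by (intro mult_mono) auto
        then have "\<bar>f x - f y\<bar> \<le> ?t" if "x \<in> unit_square" "y \<in> unit_square" for x y
          using mixed_holder_osc_le[OF f that] 3 assms \<alpha> by simp
        then have "?p = 1"
          using first_value_error[of f ?t l] mixed_holder_integrable[OF f \<alpha>] assms \<open>l > 0\<close> 3
          by (simp add: A_def)
        then show ?thesis by simp
      next
        case 4
        define L where "L = ln (real n)"
        \<comment> \<open>From \<open>n \<ge> 3\<close> follows \<open>L \<ge> 1\<close>, so higher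
          powers of \<open>L\<close> dominate lower ones.\<close>
        have "exp 1 \<le> real n"
          using 4 exp_le by linarith
        then have L: "L \<ge> 1"
          unfolding L_def using n by (subst ln_ge_iff) auto
        have sqrt_n: "sqrt n \<ge> 1" using n by simp
        \<comment> \<open>Since \<open>N \<ge> 1\<close>, rounding down loses at most a factor 2:
          \<open>sqrt n < N + 1 \<le> 2 * N\<close>.\<close>
        have N: "N \<ge> 1" "N \<le> sqrt n" "sqrt n \<le> 2 * real N"
        proof -
          have "real N = \<lfloor>sqrt n\<rfloor>" "1 \<le> \<lfloor>sqrt n\<rfloor>"
            using sqrt_n by (simp_all add: N_def)
          then show "N \<ge> 1" "N \<le> sqrt n" "sqrt n \<le> 2 * real N"
            using of_int_floor_le[of "sqrt n"] real_of_int_floor_add_one_gt[of "sqrt n"] by linarith+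
        qed
        have N_sq: "(real N)\<^sup>2 \<le> n" "n \<le> 4 * (real N)\<^sup>2"
        proof -
          show "(real N)\<^sup>2 \<le> n"
            using power_mono[OF N(2), of 2] by simp
          show "n \<le> 4 * (real N)\<^sup>2"
            using power_mono[OF N(3), of 2] by (simp add: power_mult_distrib)
        qed
        have t: "?t > 0"
          using C L n by (intro mult_pos_pos) (auto simp flip: L_def)
        let ?z = "N * ?t / (2 * c * (1 / N) powr \<alpha>)"
        have "2 * exp (- (?z\<^sup>2 / 2)) \<le> 2 * real n powr (- c1)"
        proof -
          \<comment> \<open>Here \<open>\<alpha> \<le> 1\<close> enters: it lets one factor
            \<open>N powr \<alpha>\<close> be replaced by \<open>N\<close>, and
            \<open>4 powr \<alpha>\<close> by 4.\<close>
          have "real n powr \<alpha> / 4 \<le> real N * real N powr \<alpha>"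
          proof -
            have "real n powr \<alpha> \<le> (4 * (real N)\<^sup>2) powr \<alpha>"
              using N_sq \<alpha> by (intro powr_mono2) auto
            also have "\<dots> = 4 powr \<alpha> * (real N powr \<alpha> * real N powr \<alpha>)"
              using N by (simp add: powr_mult power2_eq_square)
            also have "\<dots> \<le> 4 powr 1 * (real N powr 1 * real N powr \<alpha>)"
              using 4 N by (intro mult_mono powr_mono) auto
            finally show ?thesis using N by simp
          qed
          then have "real n powr \<alpha> / 4 * (?t / (2 * c)) \<le> real N * real N powr \<alpha> * (?t / (2 * c))"
            using t assms by (intro mult_right_mono) auto
          also have "\<dots> = ?z"
            using N assms by (simp add: powr_divide field_simps)
          \<comment> \<open>The powers of \<open>n\<close> cancel against the factor
            \<open>n powr (-\<alpha>)\<close> in the allowed error.\<close>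
          also have "real n powr \<alpha> / 4 * (?t / (2 * c)) = C / (8 * c) * L powr (3 / 2)"
            using n assms by (simp add: L_def powr_minus field_simps)
          finally have z1: "C / (8 * c) * L powr (3 / 2) \<le> ?z" .
          have "3 / 2 * sqrt c1 \<le> C / (8 * c)"
            using C assms by (simp add: field_simps)
          moreover have "sqrt L \<le> L powr (3 / 2)"
            using L by (auto simp: powr_half_sqrt[symmetric] intro!: powr_mono)
          ultimately have "3 / 2 * sqrt c1 * sqrt L \<le> C / (8 * c) * L powr (3 / 2)"
            using assms L C by (intro mult_mono) auto
          with z1 have "3 / 2 * sqrt c1 * sqrt L \<le> ?z" by linarith
          then have "(3 / 2 * sqrt c1 * sqrt L)\<^sup>2 \<le> ?z\<^sup>2"
            using assms L by (intro power_mono) auto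
          then have "9 / 4 * (c1 * L) \<le> ?z\<^sup>2"
            using assms L by (simp add: power_mult_distrib power_divide)
          moreover have "0 \<le> c1 * L" using assms L by simp
          \<comment> \<open>The constant \<open>3 / 2\<close> was chosen so that its square
            \<open>9 / 4\<close> exceeds 2.\<close>
          ultimately have "c1 * L \<le> ?z\<^sup>2 / 2" by linarith
          then show ?thesis
            using n by (simp add: powr_def L_def)
        qed
        \<comment> \<open>The grid has at most \<open>n\<close> cells, and each is missed with
          probability at most \<open>exp (- (c1 * L\<^sup>2))\<close>, hence at most
          \<open>n powr (- c1)\<close>.\<close>
        moreover have "(real N)\<^sup>2 * exp (- (l / (real N)\<^sup>2)) \<le> n * real n powr (- c1)"
        proof -
          have "c1 * L \<le> c1 * L\<^sup>2"
            using assms L by (simp add: power2_eq_square)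
          also have "\<dots> \<le> l / n"
            using l n by (simp add: L_def field_simps)
          also have "\<dots> \<le> l / (real N)\<^sup>2"
            using n N N_sq by (intro divide_left_mono) auto
          finally have "exp (- (l / (real N)\<^sup>2)) \<le> real n powr (- c1)"
            using n by (simp add: powr_def L_def)
          then show ?thesis
            using N_sq by (intro mult_mono) auto
        qed
        \<comment> \<open>The exponent 2 absorbs the prefactor: \<open>2 + n \<le> n\<^sup>2\<close>
          for \<open>n \<ge> 3\<close>.\<close>
        moreover have "2 * real n powr (- c1) + n * real n powr (- c1) \<le> real n powr (2 - c1)"
        proof -
          have "2 + real n \<le> (real n)\<^sup>2"
          proof -
            have "3 * real n \<le> real n * real n"
              using 4 by (intro mult_right_mono) auto
            then show ?thesis
              using 4 unfolding power2_eq_square by linarith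
          qed
          then have "(2 + real n) * real n powr (- c1) \<le> (real n)\<^sup>2 * real n powr (- c1)"
            by (intro mult_right_mono) auto
          also have "\<dots> = real n powr (2 - c1)"
            using n by (simp add: powr_diff powr_minus field_simps)
          finally show ?thesis by (simp add: distrib_right)
        qed
        moreover have "?p \<ge> 1 - (2 * exp (- (?z\<^sup>2 / 2)) + (real N)\<^sup>2 * exp (- (l / (real N)\<^sup>2)))"
          using grid_estimator_concentration[OF f \<alpha> \<open>c > 0\<close> t, of N l] N 4 by (simp add: A_def)
        ultimately show ?thesis by linarith
      qed
    qed
    then show "\<exists>A. \<forall>f. mixed_holder c \<alpha> f \<longrightarrow>
        \<P>(X in uniform_points l. \<bar>(LINT x:unit_square|lborel. f x) - A (sample_data f l X)\<bar> \<le> ?t)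
          \<ge> 1 - real n powr (2 - c1)"
      by (intro exI[of _ A]) blast
  qed
qed

end
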